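(* Let $\mathcal{G}\rightrightarrows M$ be a Lie groupoid with source $s$ and target $t$, let $\Theta\in\Omega^k(\mathcal{G})$ be a $k$-form and let $\theta=\mathrm{pr}_{\wedge^kT^*M}\Theta|_M=\iota^*\Theta\in\Omega^k(M)$. Define $$\Theta_l:=\Theta-s^*\theta,\qquad \Theta_r:=\Theta-t^*\theta.$$ Then $\Theta$ is affine if and only if $\Theta_l$ is a multiplicative $k$-form; likewise, $\Theta$ is affine if and only if $\Theta_r$ is a multiplicative $k$-form.
   Context: $\iota:M\hookrightarrow\mathcal{G}$ is the inclusion of units; $\mathcal{G}^{(2)}=\{(g,h): s(g)=t(h)\}$, and $m,\mathrm{pr}_1,\mathrm{pr}_2:\mathcal{G}^{(2)}\to\mathcal{G}$ are the multiplication and the two projections. $\Theta\in\Omega^k(\mathcal{G})$ is multiplicative if $m^*\Theta=\mathrm{pr}_1^*\Theta+\mathrm{pr}_2^*\Theta$. It is affine if $$m^*\Theta=\mathrm{pr}_1^*\Theta+\mathrm{pr}_2^*\Theta-\mathrm{pr}_1^*s^*\theta,\qquad \theta:=\iota^*\Theta.$$ *)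

theory Defs
  imports "HOL-Analysis.Analysis" "HOL-Library.Function_Algebras"
begin

section \<open>Smooth maps between finite-dimensional inner product spaces\<close>

text \<open>
  \<open>C_diff_on k S f\<close> is only used for open \<open>S\<close> in a finite-dimensional domain. There, being
  differentiable with all directional derivatives of class \<open>C\<^sup>k\<close> is the same as being of
  class \<open>C\<^sup>k\<^sup>+\<^sup>1\<close>.
\<close>

primrec C_diff_on ::
  "nat \<Rightarrow> 'a::real_normed_vector set \<Rightarrow> ('a \<Rightarrow> 'b::real_normed_vector) \<Rightarrow> bool" where
  "C_diff_on 0 S f \<longleftrightarrow> continuous_on S f"
| "C_diff_on (Suc k) S f \<longleftrightarrow>
     (\<forall>x\<in>S. f differentiable (at x)) \<and>
     (\<forall>v. C_diff_on k S (\<lambda>x. frechet_derivative f (at x) v))"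

definition smooth_on ::
  "'a::real_normed_vector set \<Rightarrow> ('a \<Rightarrow> 'b::real_normed_vector) \<Rightarrow> bool" where
  "smooth_on S f \<longleftrightarrow> (\<forall>k. C_diff_on k S f)"


section \<open>Smooth manifolds\<close>

text \<open>
  A chart is a pair of its domain and a map that is meaningful only on that domain.
  Model spaces are finite-dimensional types of class \<open>real_inner\<close> rather than of class
  \<open>euclidean_space\<close>, since the latter class has no zero-dimensional instance and would exclude,
  for example, Lie groups, i.e. Lie groupoids over a point.
\<close>

type_synonym ('a, 'e) chart = "'a set \<times> ('a \<Rightarrow> 'e)"

record ('a, 'e) manifold =
  mtop :: "'a topology"
  atlas :: "('a, 'e) chart set"

abbreviation mcarrier :: "('a, 'e) manifold \<Rightarrow> 'a set" where
  "mcarrier M \<equiv> topspace (mtop M)"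

definition chart_inv :: "('a, 'e) chart \<Rightarrow> 'e \<Rightarrow> 'a" where
  "chart_inv c = inv_into (fst c) (snd c)"

definition local_rep :: "('a, 'e) chart \<Rightarrow> ('b, 'f) chart \<Rightarrow> ('a \<Rightarrow> 'b) \<Rightarrow> 'e \<Rightarrow> 'f" where
  "local_rep c d f = snd d \<circ> f \<circ> chart_inv c"

definition is_chart :: "'a topology \<Rightarrow> ('a, 'e::real_inner) chart \<Rightarrow> bool" where
  "is_chart T c \<longleftrightarrow>
     openin T (fst c) \<and> open (snd c ` fst c) \<and>
     homeomorphic_map (subtopology T (fst c)) (top_of_set (snd c ` fst c)) (snd c)"

definition smooth_manifold :: "('a, 'e::real_inner) manifold \<Rightarrow> bool" where
  "smooth_manifold M \<longleftrightarrow>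
     (\<exists>B::'e set. finite B \<and> span B = UNIV) \<and>
     Hausdorff_space (mtop M) \<and> second_countable (mtop M) \<and>
     (\<forall>c\<in>atlas M. is_chart (mtop M) c) \<and>
     (\<Union>c\<in>atlas M. fst c) = mcarrier M \<and>
     (\<forall>c\<in>atlas M. \<forall>d\<in>atlas M. smooth_on (snd c ` (fst c \<inter> fst d)) (local_rep c d (\<lambda>p. p)))"

definition smooth_map ::
  "('a, 'e::real_inner) manifold \<Rightarrow> ('b, 'f::real_inner) manifold \<Rightarrow> ('a \<Rightarrow> 'b) \<Rightarrow> bool" where
  "smooth_map M N f \<longleftrightarrow>
     continuous_map (mtop M) (mtop N) f \<and>
     (\<forall>c\<in>atlas M. \<forall>d\<in>atlas N. smooth_on (snd c ` (fst c \<inter> f -` fst d)) (local_rep c d f))"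

definition charts_at :: "('a, 'e) manifold \<Rightarrow> 'a \<Rightarrow> ('a, 'e) chart set" where
  "charts_at M p = {c \<in> atlas M. p \<in> fst c}"


section \<open>Tangent spaces and differentials\<close>

text \<open>
  A tangent vector at \<open>p\<close> is the family of its coordinate vectors in all charts around \<open>p\<close>,
  related by the derivatives of the transition maps, and \<open>0\<close> at all other charts. The vector space
  structure is pointwise.
\<close>

type_synonym ('a, 'e) tangent = "('a, 'e) chart \<Rightarrow> 'e"

definition coord_deriv ::
  "('a, 'e::real_inner) chart \<Rightarrow> ('b, 'f::real_inner) chart \<Rightarrow> ('a \<Rightarrow> 'b) \<Rightarrow> 'a \<Rightarrow> 'e \<Rightarrow> 'f" where
  "coord_deriv c d f p = frechet_derivative (local_rep c d f) (at (snd c p))"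

definition tangent_space :: "('a, 'e::real_inner) manifold \<Rightarrow> 'a \<Rightarrow> ('a, 'e) tangent set" where
  "tangent_space M p =
     {\<xi>. (\<forall>c. c \<notin> charts_at M p \<longrightarrow> \<xi> c = 0) \<and>
         (\<forall>c\<in>charts_at M p. \<forall>d\<in>charts_at M p. \<xi> d = coord_deriv c d (\<lambda>q. q) p (\<xi> c))}"

text \<open>The tangent vector at \<open>p\<close> whose coordinate vector in the chart \<open>c\<close> around \<open>p\<close> is \<open>v\<close>.\<close>

definition coord_vector ::
  "('a, 'e::real_inner) manifold \<Rightarrow> ('a, 'e) chart \<Rightarrow> 'a \<Rightarrow> 'e \<Rightarrow> ('a, 'e) tangent" where
  "coord_vector M c p v =
     (\<lambda>d. if d \<in> charts_at M p then coord_deriv c d (\<lambda>q. q) p v else 0)"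

text \<open>
  By the chain rule, for a smooth map and a tangent vector \<open>\<xi>\<close> at \<open>p\<close> the result does not depend on
  the chart chosen around \<open>p\<close>.
\<close>

definition differential ::
  "('a, 'e::real_inner) manifold \<Rightarrow> ('b, 'f::real_inner) manifold \<Rightarrow> ('a \<Rightarrow> 'b) \<Rightarrow> 'a \<Rightarrow>
   ('a, 'e) tangent \<Rightarrow> ('b, 'f) tangent" where
  "differential M N f p \<xi> =
     (let c = (SOME c. c \<in> charts_at M p)
      in (\<lambda>d. if d \<in> charts_at N (f p) then coord_deriv c d f p (\<xi> c) else 0))"

definition submersion ::
  "('a, 'e::real_inner) manifold \<Rightarrow> ('b, 'f::real_inner) manifold \<Rightarrow> ('a \<Rightarrow> 'b) \<Rightarrow> bool" where
  "submersion M N f \<longleftrightarrow> smooth_map M N f \<and>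
     (\<forall>p\<in>mcarrier M. differential M N f p ` tangent_space M p = tangent_space N (f p))"

definition immersion ::
  "('a, 'e::real_inner) manifold \<Rightarrow> ('b, 'f::real_inner) manifold \<Rightarrow> ('a \<Rightarrow> 'b) \<Rightarrow> bool" where
  "immersion M N f \<longleftrightarrow> smooth_map M N f \<and>
     (\<forall>p\<in>mcarrier M. inj_on (differential M N f p) (tangent_space M p))"

definition embedded_submanifold ::
  "('a, 'e::real_inner) manifold \<Rightarrow> ('a, 'f::real_inner) manifold \<Rightarrow> bool" where
  "embedded_submanifold S N \<longleftrightarrow>
     smooth_manifold S \<and> mcarrier S \<subseteq> mcarrier N \<and>
     mtop S = subtopology (mtop N) (mcarrier S) \<and>
     immersion S N (\<lambda>p. p)"

definition prod_manifold ::
  "('a, 'e) manifold \<Rightarrow> ('b, 'f) manifold \<Rightarrow> ('a \<times> 'b, 'e \<times> 'f) manifold" where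
  "prod_manifold M N =
     \<lparr> mtop = prod_topology (mtop M) (mtop N),
       atlas = {(fst c \<times> fst d, map_prod (snd c) (snd d)) | c d. c \<in> atlas M \<and> d \<in> atlas N} \<rparr>"


section \<open>Differential forms\<close>

text \<open>
  Forms are made extensional (\<open>0\<close> outside their proper domain), so that equality of forms is
  equality of functions and sums and differences of forms are the pointwise ones.
\<close>

type_synonym ('a, 'e) form = "'a \<Rightarrow> ('a, 'e) tangent list \<Rightarrow> real"

definition alternating_multilinear ::
  "nat \<Rightarrow> ('a, 'e::real_inner) tangent set \<Rightarrow> (('a, 'e) tangent list \<Rightarrow> real) \<Rightarrow> bool" where
  "alternating_multilinear k T \<alpha> \<longleftrightarrow>
     (\<forall>\<xi>s. length \<xi>s = k \<and> set \<xi>s \<subseteq> T \<longrightarrow>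
        (\<forall>i<k. \<forall>\<xi>\<in>T. \<forall>\<eta>\<in>T. \<forall>a b.
           \<alpha> (\<xi>s[i := (\<lambda>c. a *\<^sub>R \<xi> c + b *\<^sub>R \<eta> c)]) = a * \<alpha> (\<xi>s[i := \<xi>]) + b * \<alpha> (\<xi>s[i := \<eta>])) \<and>
        (\<forall>i<k. \<forall>j<k. i \<noteq> j \<and> \<xi>s ! i = \<xi>s ! j \<longrightarrow> \<alpha> \<xi>s = 0))"

definition forms :: "nat \<Rightarrow> ('a, 'e::real_inner) manifold \<Rightarrow> ('a, 'e) form set" where
  "forms k M =
     {\<omega>. (\<forall>p\<in>mcarrier M. alternating_multilinear k (tangent_space M p) (\<omega> p)) \<and>
         (\<forall>c\<in>atlas M. \<forall>vs. length vs = k \<longrightarrow>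
            smooth_on (snd c ` fst c)
              (\<lambda>x. \<omega> (chart_inv c x) (map (coord_vector M c (chart_inv c x)) vs))) \<and>
         (\<forall>p \<xi>s. \<not> (p \<in> mcarrier M \<and> length \<xi>s = k \<and> set \<xi>s \<subseteq> tangent_space M p) \<longrightarrow> \<omega> p \<xi>s = 0)}"

definition pullback ::
  "('a, 'e::real_inner) manifold \<Rightarrow> ('b, 'f::real_inner) manifold \<Rightarrow> ('a \<Rightarrow> 'b) \<Rightarrow>
   ('b, 'f) form \<Rightarrow> ('a, 'e) form" where
  "pullback M N f \<omega> =
     (\<lambda>p \<xi>s. if p \<in> mcarrier M \<and> set \<xi>s \<subseteq> tangent_space M p
             then \<omega> (f p) (map (differential M N f p) \<xi>s) else 0)"


section \<open>Lie groupoids\<close>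

text \<open>
  The component \<open>pairs\<close> is the manifold of composable pairs. It is required below to be an embedded
  submanifold of the product of the arrow manifold with itself. Such a smooth structure always
  exists, because source and target are submersions, and is unique up to equivalence of atlases;
  so it is no additional structure. Its model space is an arbitrary type variable, since its
  dimension (twice that of the arrow manifold minus that of the base) cannot be expressed as a type.
\<close>

record ('g, 'm, 'eg, 'em, 'ep) groupoid_data =
  arrows :: "('g, 'eg) manifold"
  base :: "('m, 'em) manifold"
  pairs :: "('g \<times> 'g, 'ep) manifold"
  src :: "'g \<Rightarrow> 'm"
  tgt :: "'g \<Rightarrow> 'm"
  mult :: "'g \<times> 'g \<Rightarrow> 'g"
  unit :: "'m \<Rightarrow> 'g"
  invs :: "'g \<Rightarrow> 'g"

definition algebraic_groupoid ::
  "('g, 'm, 'eg, 'em, 'ep) groupoid_data \<Rightarrow> bool" where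
  "algebraic_groupoid \<G> \<longleftrightarrow>
    (let G = mcarrier (arrows \<G>); M = mcarrier (base \<G>);
         s = src \<G>; t = tgt \<G>; m = mult \<G>; u = unit \<G>; i = invs \<G>
     in (\<forall>g\<in>G. s g \<in> M \<and> t g \<in> M) \<and>
        (\<forall>x\<in>M. u x \<in> G \<and> s (u x) = x \<and> t (u x) = x) \<and>
        (\<forall>g\<in>G. \<forall>h\<in>G. s g = t h \<longrightarrow> m (g, h) \<in> G \<and> s (m (g, h)) = s h \<and> t (m (g, h)) = t g) \<and>
        (\<forall>g\<in>G. \<forall>h\<in>G. \<forall>k\<in>G. s g = t h \<and> s h = t k \<longrightarrow> m (m (g, h), k) = m (g, m (h, k))) \<and>
        (\<forall>g\<in>G. m (u (t g), g) = g \<and> m (g, u (s g)) = g) \<and>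
        (\<forall>g\<in>G. i g \<in> G \<and> s (i g) = t g \<and> t (i g) = s g \<and>
               m (g, i g) = u (t g) \<and> m (i g, g) = u (s g)))"

definition lie_groupoid ::
  "('g, 'm, 'eg::real_inner, 'em::real_inner, 'ep::real_inner) groupoid_data \<Rightarrow> bool" where
  "lie_groupoid \<G> \<longleftrightarrow>
     algebraic_groupoid \<G> \<and>
     smooth_manifold (arrows \<G>) \<and> smooth_manifold (base \<G>) \<and>
     submersion (arrows \<G>) (base \<G>) (src \<G>) \<and>
     submersion (arrows \<G>) (base \<G>) (tgt \<G>) \<and>
     mcarrier (pairs \<G>) =
       {(g, h). g \<in> mcarrier (arrows \<G>) \<and> h \<in> mcarrier (arrows \<G>) \<and> src \<G> g = tgt \<G> h} \<and>
     embedded_submanifold (pairs \<G>) (prod_manifold (arrows \<G>) (arrows \<G>)) \<and>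
     smooth_map (pairs \<G>) (arrows \<G>) (mult \<G>) \<and>
     smooth_map (base \<G>) (arrows \<G>) (unit \<G>) \<and>
     smooth_map (arrows \<G>) (arrows \<G>) (invs \<G>)"


section \<open>Multiplicative and affine forms\<close>

text \<open>The projections of the manifold of composable pairs are \<open>fst\<close> and \<open>snd\<close>.\<close>

definition multiplicative_form ::
  "('g, 'm, 'eg::real_inner, 'em::real_inner, 'ep::real_inner) groupoid_data \<Rightarrow> nat \<Rightarrow>
   ('g, 'eg) form \<Rightarrow> bool" where
  "multiplicative_form \<G> k \<Theta> \<longleftrightarrow>
     \<Theta> \<in> forms k (arrows \<G>) \<and>
     pullback (pairs \<G>) (arrows \<G>) (mult \<G>) \<Theta> =
       pullback (pairs \<G>) (arrows \<G>) fst \<Theta> + pullback (pairs \<G>) (arrows \<G>) snd \<Theta>"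

definition base_form ::
  "('g, 'm, 'eg::real_inner, 'em::real_inner, 'ep::real_inner) groupoid_data \<Rightarrow>
   ('g, 'eg) form \<Rightarrow> ('m, 'em) form" where
  "base_form \<G> \<Theta> = pullback (base \<G>) (arrows \<G>) (unit \<G>) \<Theta>"

definition affine_form ::
  "('g, 'm, 'eg::real_inner, 'em::real_inner, 'ep::real_inner) groupoid_data \<Rightarrow> nat \<Rightarrow>
   ('g, 'eg) form \<Rightarrow> bool" where
  "affine_form \<G> k \<Theta> \<longleftrightarrow>
     \<Theta> \<in> forms k (arrows \<G>) \<and>
     pullback (pairs \<G>) (arrows \<G>) (mult \<G>) \<Theta> =
       pullback (pairs \<G>) (arrows \<G>) fst \<Theta> + pullback (pairs \<G>) (arrows \<G>) snd \<Theta>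
       - pullback (pairs \<G>) (arrows \<G>) fst
           (pullback (arrows \<G>) (base \<G>) (src \<G>) (base_form \<G> \<Theta>))"

end

theory Submission
  imports Defs
begin

text \<open>
  Write \<open>\<theta> = \<iota>\<^sup>*\<Theta>\<close>. On composable pairs \<open>s \<circ> m = s \<circ> pr\<^sub>2\<close>, \<open>t \<circ> m = t \<circ> pr\<^sub>1\<close> and
  \<open>t \<circ> pr\<^sub>2 = s \<circ> pr\<^sub>1\<close>. Functoriality of the pullback turns the first identity into
  \<open>m\<^sup>*s\<^sup>*\<theta> = pr\<^sub>2\<^sup>*s\<^sup>*\<theta>\<close>, so that after the substitution \<open>\<Theta>\<^sub>l = \<Theta> - s\<^sup>*\<theta>\<close> the terms
  \<open>pr\<^sub>2\<^sup>*s\<^sup>*\<theta>\<close> on both sides of the multiplicativity equation cancel and \<open>- pr\<^sub>1\<^sup>*s\<^sup>*\<theta>\<close> is left,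
  which is the correction term of the affine equation. For \<open>\<Theta>\<^sub>r\<close> the terms \<open>pr\<^sub>1\<^sup>*t\<^sup>*\<theta>\<close> cancel,
  and what is left is \<open>- pr\<^sub>2\<^sup>*t\<^sup>*\<theta> = - pr\<^sub>1\<^sup>*s\<^sup>*\<theta>\<close> again.

  Besides this computation there are two analytic facts. Functoriality (\<open>pullback_comp\<close>) is the
  chain rule in charts. That \<open>\<Theta>\<^sub>l\<close> and \<open>\<Theta>\<^sub>r\<close> are forms at all follows because the pullback
  of a form along a smooth map is a form (\<open>pullback_form\<close>); its coefficients are polynomials in the
  first derivatives of the map and in the coefficients of the original form along the map, so
  that smoothness comes down to smoothness of sums, products and composites. Functoriality is
  also applied to \<open>pr\<^sub>1\<close> and \<open>pr\<^sub>2\<close>, whose smoothness (\<open>smooth_map_projections\<close>) comes from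
  that of the inclusion of the composable pairs into the product.
\<close>

section \<open>Calculus of smooth functions\<close>

lemma frechet_derivative_cong_open:
  assumes "open S" "x \<in> S" "\<And>y. y \<in> S \<Longrightarrow> f y = g y"
  shows "frechet_derivative f (at x) = frechet_derivative g (at x)"
proof -
  have "(f has_derivative D) (at x) \<longleftrightarrow> (g has_derivative D) (at x)" for D
    using assms has_derivative_transform_within_open[of f D x UNIV S g]
      has_derivative_transform_within_open[of g D x UNIV S f] by auto
  then show ?thesis by (simp add: frechet_derivative_def)
qed

lemma differentiable_cong_open:
  assumes "open S" "x \<in> S" "\<And>y. y \<in> S \<Longrightarrow> f y = g y" "f differentiable (at x)"
  shows "g differentiable (at x)"
  using assms has_derivative_transform_within_open[of f _ x UNIV S g]
  unfolding differentiable_def by auto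

lemma C_diff_on_cong:
  assumes "open S" "\<And>y. y \<in> S \<Longrightarrow> f y = g y" "C_diff_on k S f"
  shows "C_diff_on k S g"
  using assms(2,3)
proof (induction k arbitrary: f g)
  case 0
  then show ?case using continuous_on_cong[of S S f g] by simp
next
  case (Suc k)
  have "C_diff_on k S (\<lambda>x. frechet_derivative g (at x) v)" for v
    using Suc.IH[of "\<lambda>x. frechet_derivative f (at x) v" "\<lambda>x. frechet_derivative g (at x) v"]
      Suc.prems frechet_derivative_cong_open[OF assms(1), of _ f g] by simp
  then show ?case
    using Suc.prems differentiable_cong_open[OF assms(1), of _ f g] by simp
qed

lemma C_diff_on_Suc_imp: "C_diff_on (Suc k) S f \<Longrightarrow> C_diff_on k S f"
proof (induction k arbitrary: f)
  case 0
  then show ?case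
    by (auto intro!: continuous_at_imp_continuous_on differentiable_imp_continuous_within)
next
  case (Suc k)
  then show ?case by simp
qed

lemma C_diff_on_local:
  assumes "\<And>x. x \<in> S \<Longrightarrow> \<exists>U. open U \<and> x \<in> U \<and> C_diff_on k U f"
  shows "C_diff_on k S f"
  using assms
proof (induction k arbitrary: f)
  case 0
  have "continuous (at x) f" if "x \<in> S" for x
    using 0[OF that] continuous_on_eq_continuous_at by auto
  then show ?case by (simp add: continuous_at_imp_continuous_on)
next
  case (Suc k)
  have "C_diff_on k S (\<lambda>x. frechet_derivative f (at x) v)" for v
    by (rule Suc.IH) (use Suc.prems in fastforce)
  then show ?case using Suc.prems by fastforce
qed

lemma C_diff_on_const: "C_diff_on k S (\<lambda>x. c)"
  by (induction k arbitrary: c) (auto simp: frechet_derivative_const)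

lemma C_diff_on_linear:
  assumes "bounded_linear L" "open S" "C_diff_on k S f"
  shows "C_diff_on k S (\<lambda>x. L (f x))"
  using assms(3)
proof (induction k arbitrary: f)
  case 0
  then show ?case using bounded_linear.continuous_on[OF assms(1)] by auto
next
  case (Suc k)
  have D: "((\<lambda>x. L (f x)) has_derivative (\<lambda>v. L (frechet_derivative f (at x) v))) (at x)"
    if "x \<in> S" for x
    by (rule bounded_linear.has_derivative[OF assms(1)])
      (use Suc.prems that in \<open>simp add: frechet_derivative_works[symmetric]\<close>)
  have "C_diff_on k S (\<lambda>x. frechet_derivative (\<lambda>x. L (f x)) (at x) v)" for v
    by (rule C_diff_on_cong[OF assms(2) _ Suc.IH[of "\<lambda>x. frechet_derivative f (at x) v"]])
      (use Suc.prems in \<open>simp_all add: frechet_derivative_at[OF D, symmetric]\<close>)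
  then show ?case using D by (auto simp: differentiable_def)
qed

lemma C_diff_on_add:
  assumes "open S" "C_diff_on k S f" "C_diff_on k S g"
  shows "C_diff_on k S (\<lambda>x. f x + g x)"
  using assms(2,3)
proof (induction k arbitrary: f g)
  case 0
  then show ?case by (simp add: continuous_on_add)
next
  case (Suc k)
  have D: "((\<lambda>x. f x + g x) has_derivative
      (\<lambda>v. frechet_derivative f (at x) v + frechet_derivative g (at x) v)) (at x)"
    if "x \<in> S" for x
    by (rule has_derivative_add)
      (use Suc.prems that in \<open>simp_all add: frechet_derivative_works[symmetric]\<close>)
  have "C_diff_on k S (\<lambda>x. frechet_derivative (\<lambda>x. f x + g x) (at x) v)" for v
    by (rule C_diff_on_cong[OF assms(1) _ Suc.IH[of "\<lambda>x. frechet_derivative f (at x) v"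
            "\<lambda>x. frechet_derivative g (at x) v"]])
      (use Suc.prems in \<open>simp_all add: frechet_derivative_at[OF D, symmetric]\<close>)
  then show ?case using D by (auto simp: differentiable_def)
qed

lemma C_diff_on_scaleR:
  assumes "open S" "C_diff_on k S f" "C_diff_on k S g"
  shows "C_diff_on k S (\<lambda>x. f x *\<^sub>R g x)"
  using assms(2,3)
proof (induction k arbitrary: f g)
  case 0
  then show ?case by (simp add: continuous_on_scaleR)
next
  case (Suc k)
  have D: "((\<lambda>x. f x *\<^sub>R g x) has_derivative
      (\<lambda>v. f x *\<^sub>R frechet_derivative g (at x) v + frechet_derivative f (at x) v *\<^sub>R g x)) (at x)"
    if "x \<in> S" for x
    by (rule has_derivative_scaleR)
      (use Suc.prems that in \<open>simp_all add: frechet_derivative_works[symmetric]\<close>)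
  have "C_diff_on k S (\<lambda>x. f x *\<^sub>R frechet_derivative g (at x) v
      + frechet_derivative f (at x) v *\<^sub>R g x)" for v
    using Suc.prems C_diff_on_Suc_imp[OF Suc.prems(1)] C_diff_on_Suc_imp[OF Suc.prems(2)]
    by (intro C_diff_on_add assms(1) Suc.IH) auto
  then have "C_diff_on k S (\<lambda>x. frechet_derivative (\<lambda>x. f x *\<^sub>R g x) (at x) v)" for v
    by (rule C_diff_on_cong[OF assms(1), rotated])
      (simp add: frechet_derivative_at[OF D, symmetric])
  then show ?case using D by (auto simp: differentiable_def)
qed

lemma C_diff_on_sum:
  assumes "open S" "\<And>b. b \<in> B \<Longrightarrow> C_diff_on k S (f b)"
  shows "C_diff_on k S (\<lambda>x. \<Sum>b\<in>B. f b x)"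
  using assms(2)
  by (induction B rule: infinite_finite_induct) (auto intro: C_diff_on_const C_diff_on_add assms(1))

text \<open>
  The model spaces are not of class \<open>euclidean_space\<close>, so there is no standard basis.
  Gram-Schmidt, applied to a finite spanning set, supplies a substitute whose coordinate functionals are
  inner products and hence bounded. Zero vectors may occur in \<open>B\<close>; their coefficient is
  \<open>x / 0 = 0\<close>.
\<close>

lemma orthogonal_expansion:
  assumes "\<exists>B::'e::real_inner set. finite B \<and> span B = UNIV"
  obtains B :: "'e::real_inner set" where "finite B" "\<And>v. v = (\<Sum>b\<in>B. ((v \<bullet> b) / (b \<bullet> b)) *\<^sub>R b)"
proof -
  from assms obtain B0 :: "'e set" where "finite B0" "span B0 = UNIV" by blast
  with basis_orthogonal[of B0] obtain B where
    B: "finite B" "span B = (UNIV :: 'e set)" "pairwise orthogonal B" by auto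
  have "v = (\<Sum>b\<in>B. ((v \<bullet> b) / (b \<bullet> b)) *\<^sub>R b)" for v
  proof -
    let ?w = "v - (\<Sum>b\<in>B. ((v \<bullet> b) / (b \<bullet> b)) *\<^sub>R b)"
    have "orthogonal ?w a" if "a \<in> B" for a
    proof -
      have "(\<Sum>b\<in>B. ((v \<bullet> b) / (b \<bullet> b)) * (b \<bullet> a)) =
          (\<Sum>b\<in>B. if b = a then ((v \<bullet> a) / (a \<bullet> a)) * (a \<bullet> a) else 0)"
        using B(3) that by (intro sum.cong) (auto simp: pairwise_def orthogonal_def)
      also have "\<dots> = v \<bullet> a" using that B(1) by simp
      finally show ?thesis
        by (simp add: orthogonal_def inner_diff_left inner_sum_left)
    qed
    then have "orthogonal ?w ?w"
      using B(2) orthogonal_to_span[of ?w B ?w] by auto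
    then show ?thesis by (simp add: orthogonal_self)
  qed
  with B(1) show ?thesis using that by blast
qed

lemma smooth_on_cong:
  "open S \<Longrightarrow> (\<And>y. y \<in> S \<Longrightarrow> f y = g y) \<Longrightarrow> smooth_on S f \<Longrightarrow> smooth_on S g"
  using C_diff_on_cong unfolding smooth_on_def by blast

lemma smooth_on_local:
  assumes "\<And>x. x \<in> S \<Longrightarrow> \<exists>U. open U \<and> x \<in> U \<and> smooth_on U f"
  shows "smooth_on S f"
  unfolding smooth_on_def
proof
  fix k
  show "C_diff_on k S f"
    by (rule C_diff_on_local) (use assms in \<open>auto simp: smooth_on_def\<close>)
qed

lemma smooth_on_linear:
  "bounded_linear L \<Longrightarrow> open S \<Longrightarrow> smooth_on S f \<Longrightarrow> smooth_on S (\<lambda>x. L (f x))"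
  by (simp add: smooth_on_def C_diff_on_linear)

lemma smooth_on_diff:
  assumes "open S" "smooth_on S f" "smooth_on S g"
  shows "smooth_on S (\<lambda>x. f x - g x)"
  using assms C_diff_on_add[OF assms(1), of _ f "\<lambda>x. - g x"]
    C_diff_on_linear[OF bounded_linear_minus[OF bounded_linear_ident] assms(1), of _ g]
  by (simp add: smooth_on_def)

lemma smooth_on_scaleR:
  "open S \<Longrightarrow> smooth_on S f \<Longrightarrow> smooth_on S g \<Longrightarrow> smooth_on S (\<lambda>x. f x *\<^sub>R g x)"
  by (simp add: smooth_on_def C_diff_on_scaleR)

lemma smooth_on_sum:
  "open S \<Longrightarrow> (\<And>b. b \<in> B \<Longrightarrow> smooth_on S (f b)) \<Longrightarrow> smooth_on S (\<lambda>x. \<Sum>b\<in>B. f b x)"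
  by (simp add: smooth_on_def C_diff_on_sum)

lemma smooth_on_differentiable: "smooth_on S f \<Longrightarrow> x \<in> S \<Longrightarrow> f differentiable (at x)"
  using C_diff_on.simps(2)[of 0 S f] unfolding smooth_on_def by metis

lemma smooth_on_derivative: "smooth_on S f \<Longrightarrow> smooth_on S (\<lambda>x. frechet_derivative f (at x) v)"
  unfolding smooth_on_def
proof
  fix k
  assume "\<forall>k. C_diff_on k S f"
  then have "C_diff_on (Suc k) S f" ..
  then show "C_diff_on k S (\<lambda>x. frechet_derivative f (at x) v)" by simp
qed

text \<open>
  The chain rule expresses \<open>D(g \<circ> f)(x) v\<close> through \<open>Dg\<close> in the direction \<open>Df(x) v\<close>, which moves with
  \<open>x\<close>, while \<open>C_diff_on\<close> speaks of fixed directions only. Expanding \<open>Df(x) v\<close> in a finite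
  orthogonal family of the intermediate space reduces to fixed directions.
\<close>

lemma smooth_on_compose:
  fixes f :: "'a::real_normed_vector \<Rightarrow> 'b::real_inner" and g :: "'b \<Rightarrow> 'c::real_normed_vector"
  assumes fin: "\<exists>B::'b set. finite B \<and> span B = UNIV"
    and S: "open S" and f: "smooth_on S f" and g: "smooth_on T g" and fS: "f ` S \<subseteq> T"
  shows "smooth_on S (\<lambda>x. g (f x))"
proof -
  obtain B :: "'b set" where B: "finite B" "\<And>v. v = (\<Sum>b\<in>B. ((v \<bullet> b) / (b \<bullet> b)) *\<^sub>R b)"
    using orthogonal_expansion[OF fin] by blast
  have "C_diff_on k S (\<lambda>x. g (f x))" for k
    using g
  proof (induction k arbitrary: g)
    case 0
    have "continuous_on S f" "continuous_on T g"
      using f 0 C_diff_on.simps(1) unfolding smooth_on_def by blast+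
    then show ?case using fS by (simp add: continuous_on_compose2)
  next
    case (Suc k)
    have D: "((\<lambda>x. g (f x)) has_derivative
        (\<lambda>v. frechet_derivative g (at (f x)) (frechet_derivative f (at x) v))) (at x)"
      if "x \<in> S" for x
    proof (rule has_derivative_compose[of f _ x UNIV g])
      show "(f has_derivative frechet_derivative f (at x)) (at x)"
        using smooth_on_differentiable[OF f that] by (simp add: frechet_derivative_works[symmetric])
      show "(g has_derivative frechet_derivative g (at (f x))) (at (f x))"
        using smooth_on_differentiable[OF Suc.prems, of "f x"] fS that
        by (auto simp: frechet_derivative_works[symmetric])
    qed
    have expand: "frechet_derivative g (at (f x)) w =
        (\<Sum>b\<in>B. ((w \<bullet> b) / (b \<bullet> b)) *\<^sub>R frechet_derivative g (at (f x)) b)"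
      if "x \<in> S" for x w
    proof -
      have lin: "linear (frechet_derivative g (at (f x)))"
        using smooth_on_differentiable[OF Suc.prems, of "f x"] fS that linear_frechet_derivative
        by blast
      show ?thesis
        by (subst B(2)[of w]) (simp add: linear_sum[OF lin] linear_scale[OF lin])
    qed
    have "C_diff_on k S (\<lambda>x. \<Sum>b\<in>B. ((frechet_derivative f (at x) v \<bullet> b) / (b \<bullet> b)) *\<^sub>R
        frechet_derivative g (at (f x)) b)" for v
    proof (intro C_diff_on_sum C_diff_on_scaleR S)
      fix b
      show "C_diff_on k S (\<lambda>x. frechet_derivative g (at (f x)) b)"
        by (rule Suc.IH[OF smooth_on_derivative[OF Suc.prems]])
      have "bounded_linear (\<lambda>u. (u \<bullet> b) / (b \<bullet> b))"
        by (rule bounded_linear_compose[OF bounded_linear_divide bounded_linear_inner_left])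
      then show "C_diff_on k S (\<lambda>x. (frechet_derivative f (at x) v \<bullet> b) / (b \<bullet> b))"
        using C_diff_on_linear[of "\<lambda>u. (u \<bullet> b) / (b \<bullet> b)", OF _ S]
          smooth_on_derivative[OF f, of v]
        by (simp add: smooth_on_def)
    qed
    then have "C_diff_on k S (\<lambda>x. frechet_derivative (\<lambda>x. g (f x)) (at x) v)" for v
      by (rule C_diff_on_cong[OF S, rotated])
        (simp add: frechet_derivative_at[OF D, symmetric] expand[symmetric])
    then show ?case using D by (auto simp: differentiable_def)
  qed
  then show ?thesis by (simp add: smooth_on_def)
qed

section \<open>Charts and the chain rule\<close>

lemma chart_inv_left:
  assumes "smooth_manifold M" "c \<in> atlas M" "p \<in> fst c"
  shows "chart_inv c (snd c p) = p"
proof -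
  have c: "openin (mtop M) (fst c)"
    "homeomorphic_map (subtopology (mtop M) (fst c)) (top_of_set (snd c ` fst c)) (snd c)"
    using assms unfolding smooth_manifold_def is_chart_def by blast+
  have "inj_on (snd c) (fst c)"
    using homeomorphic_imp_injective_map[OF c(2)] openin_subset[OF c(1)]
    by (simp add: topspace_subtopology Int_absorb1)
  then show ?thesis using assms(3) by (simp add: chart_inv_def)
qed

lemma chart_inv_right: "x \<in> snd c ` fst c \<Longrightarrow> snd c (chart_inv c x) = x"
  by (simp add: chart_inv_def f_inv_into_f)

lemma chart_inv_in: "x \<in> snd c ` fst c \<Longrightarrow> chart_inv c x \<in> fst c"
  by (simp add: chart_inv_def inv_into_into)

lemma chart_domain_open: "smooth_manifold M \<Longrightarrow> c \<in> atlas M \<Longrightarrow> openin (mtop M) (fst c)"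
  unfolding smooth_manifold_def is_chart_def by blast

lemma chart_subset: "smooth_manifold M \<Longrightarrow> c \<in> atlas M \<Longrightarrow> fst c \<subseteq> mcarrier M"
  by (rule openin_subset[OF chart_domain_open])

lemma chart_image_open: "smooth_manifold M \<Longrightarrow> c \<in> atlas M \<Longrightarrow> open (snd c ` fst c)"
  unfolding smooth_manifold_def is_chart_def by blast

lemma charts_at_nonempty:
  assumes "smooth_manifold M" "p \<in> mcarrier M"
  shows "\<exists>c. c \<in> charts_at M p"
proof -
  have "p \<in> (\<Union>c\<in>atlas M. fst c)"
    using assms by (simp only: smooth_manifold_def)
  then show ?thesis by (auto simp: charts_at_def)
qed

lemma open_chart_domain:
  assumes M: "smooth_manifold M" and c: "c \<in> atlas M"
    and f: "continuous_map (mtop M) Y f" and V: "openin Y V"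
  shows "open (snd c ` (fst c \<inter> f -` V))"
proof -
  have ch: "openin (mtop M) (fst c)" "open (snd c ` fst c)"
    "homeomorphic_map (subtopology (mtop M) (fst c)) (top_of_set (snd c ` fst c)) (snd c)"
    using M c unfolding smooth_manifold_def is_chart_def by blast+
  have "openin (mtop M) (fst c \<inter> {p \<in> topspace (mtop M). f p \<in> V})"
    using openin_continuous_map_preimage[OF f V] ch(1) by blast
  moreover have "fst c \<inter> {p \<in> topspace (mtop M). f p \<in> V} = fst c \<inter> f -` V"
    using chart_subset[OF M c] by auto
  ultimately have "openin (subtopology (mtop M) (fst c)) (fst c \<inter> f -` V)"
    using ch(1) by (simp add: openin_open_subtopology)
  then have "openin (top_of_set (snd c ` fst c)) (snd c ` (fst c \<inter> f -` V))"
    using homeomorphic_imp_open_map[OF ch(3)] unfolding open_map_def by blast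
  then show ?thesis using ch(2) openin_open_trans by blast
qed

lemma open_local_rep_domain:
  assumes "smooth_manifold M" "smooth_manifold N" "smooth_map M N f" "c \<in> atlas M" "d \<in> atlas N"
  shows "open (snd c ` (fst c \<inter> f -` fst d))"
  using assms open_chart_domain[of M c "mtop N" f "fst d"]
  unfolding smooth_map_def smooth_manifold_def is_chart_def by blast

text \<open>
  Transition maps are the local representations of the identity, so that every change of chart
  below is an instance of the chain rule \<open>coord_deriv_comp\<close> with the identity as one factor.
\<close>

lemma smooth_map_ident: "smooth_manifold M \<Longrightarrow> smooth_map M M (\<lambda>p. p)"
  unfolding smooth_map_def smooth_manifold_def by (auto simp: vimage_def Int_def)

lemma smooth_map_in:
  "smooth_map M N f \<Longrightarrow> p \<in> mcarrier M \<Longrightarrow> f p \<in> mcarrier N"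
  unfolding smooth_map_def by (auto simp: continuous_map_def Pi_iff)

lemma has_derivative_local_rep:
  assumes "smooth_map M N f" "c \<in> charts_at M p" "d \<in> charts_at N (f p)"
  shows "(local_rep c d f has_derivative coord_deriv c d f p) (at (snd c p))"
proof -
  have "smooth_on (snd c ` (fst c \<inter> f -` fst d)) (local_rep c d f)"
    using assms unfolding smooth_map_def charts_at_def by blast
  moreover have "snd c p \<in> snd c ` (fst c \<inter> f -` fst d)"
    using assms unfolding charts_at_def by blast
  ultimately show ?thesis
    unfolding coord_deriv_def by (simp add: frechet_derivative_works[symmetric] smooth_on_differentiable)
qed

lemma linear_coord_deriv:
  assumes "smooth_map M N f" "c \<in> charts_at M p" "d \<in> charts_at N (f p)"
  shows "linear (coord_deriv c d f p)"
  using has_derivative_linear[OF has_derivative_local_rep[OF assms]] .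

text \<open>
  The composite enters as a separate function \<open>h\<close>, equal to \<open>g \<circ> f\<close> on the carrier only, because
  the structure maps of a groupoid satisfy their identities on composable pairs only. Charts have
  open domains, so derivatives do not see the difference.
\<close>

lemma coord_deriv_comp:
  assumes M: "smooth_manifold M" and N: "smooth_manifold N"
    and f: "smooth_map M N f" and g: "smooth_map N K g"
    and h: "\<And>q. q \<in> mcarrier M \<Longrightarrow> h q = g (f q)"
    and c: "c \<in> charts_at M p" and d: "d \<in> charts_at N (f p)" and e: "e \<in> charts_at K (g (f p))"
  shows "coord_deriv c e h p v = coord_deriv d e g (f p) (coord_deriv c d f p v)"
proof -
  have c': "c \<in> atlas M" "p \<in> fst c" and d': "d \<in> atlas N" "f p \<in> fst d"
    using c d by (auto simp: charts_at_def)
  let ?U = "snd c ` (fst c \<inter> f -` fst d)"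
  have U: "open ?U" by (rule open_local_rep_domain[OF M N f c'(1) d'(1)])
  have eq: "local_rep d e g (local_rep c d f x) = local_rep c e h x" if "x \<in> ?U" for x
  proof -
    from that obtain q where q: "x = snd c q" "q \<in> fst c" "f q \<in> fst d" by auto
    then show ?thesis
      using chart_inv_left[OF M c'(1)] chart_inv_left[OF N d'(1)] h[of q] chart_subset[OF M c'(1)]
      by (auto simp: local_rep_def)
  qed
  have "local_rep c d f (snd c p) = snd d (f p)"
    using chart_inv_left[OF M c'] by (simp add: local_rep_def)
  then have "((\<lambda>x. local_rep d e g (local_rep c d f x)) has_derivative
      (\<lambda>v. coord_deriv d e g (f p) (coord_deriv c d f p v))) (at (snd c p))"
    using has_derivative_compose[OF has_derivative_local_rep[OF f c d], of "local_rep d e g"]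
      has_derivative_local_rep[OF g d e] by simp
  then have "(local_rep c e h has_derivative
      (\<lambda>v. coord_deriv d e g (f p) (coord_deriv c d f p v))) (at (snd c p))"
    by (rule has_derivative_transform_within_open[OF _ U]) (use c' d' eq in auto)
  from frechet_derivative_at[OF this] show ?thesis by (simp add: coord_deriv_def fun_eq_iff)
qed

lemma coord_deriv_ident:
  assumes M: "smooth_manifold M" and c: "c \<in> charts_at M p"
  shows "coord_deriv c c (\<lambda>q. q) p v = v"
proof -
  have c': "c \<in> atlas M" "p \<in> fst c" using c by (auto simp: charts_at_def)
  have "frechet_derivative (local_rep c c (\<lambda>q. q)) (at (snd c p)) =
      frechet_derivative (\<lambda>x. x) (at (snd c p))"
    by (rule frechet_derivative_cong_open[OF chart_image_open[OF M c'(1)]])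
      (use c' in \<open>auto simp: local_rep_def chart_inv_right\<close>)
  then show ?thesis by (simp add: coord_deriv_def frechet_derivative_ident)
qed

section \<open>Tangent vectors and differentials\<close>

lemma some_chart_in:
  "smooth_manifold M \<Longrightarrow> p \<in> mcarrier M \<Longrightarrow> (SOME c. c \<in> charts_at M p) \<in> charts_at M p"
  by (rule someI_ex[OF charts_at_nonempty])

lemma charts_at_carrier: "smooth_manifold M \<Longrightarrow> c \<in> charts_at M p \<Longrightarrow> p \<in> mcarrier M"
  using chart_subset unfolding charts_at_def by blast

lemma tangent_space_coord:
  assumes "\<xi> \<in> tangent_space M p" "c \<in> charts_at M p" "d \<in> charts_at M p"
  shows "\<xi> d = coord_deriv c d (\<lambda>q. q) p (\<xi> c)"
  by (rule assms(1)[unfolded tangent_space_def mem_Collect_eq, THEN conjunct2,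
        THEN bspec, OF assms(2), THEN bspec, OF assms(3)])

lemma tangent_space_zero:
  assumes "\<xi> \<in> tangent_space M p" "c \<notin> charts_at M p"
  shows "\<xi> c = 0"
  using assms(1)[unfolded tangent_space_def mem_Collect_eq, THEN conjunct1] assms(2) by blast

lemma tangent_space_linear:
  assumes M: "smooth_manifold M"
    and \<xi>: "\<xi> \<in> tangent_space M p" and \<eta>: "\<eta> \<in> tangent_space M p"
  shows "(\<lambda>c. a *\<^sub>R \<xi> c + b *\<^sub>R \<eta> c) \<in> tangent_space M p"
proof -
  have "a *\<^sub>R \<xi> d + b *\<^sub>R \<eta> d = coord_deriv c d (\<lambda>q. q) p (a *\<^sub>R \<xi> c + b *\<^sub>R \<eta> c)"
    if c: "c \<in> charts_at M p" and d: "d \<in> charts_at M p" for c d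
  proof -
    have lin: "linear (coord_deriv c d (\<lambda>q. q) p)"
      by (rule linear_coord_deriv[OF smooth_map_ident[OF M] c d])
    show ?thesis
      unfolding tangent_space_coord[OF \<xi> c d] tangent_space_coord[OF \<eta> c d]
      by (simp add: linear_add[OF lin] linear_scale[OF lin])
  qed
  moreover have "a *\<^sub>R \<xi> c + b *\<^sub>R \<eta> c = 0" if "c \<notin> charts_at M p" for c
    by (simp add: tangent_space_zero[OF \<xi> that] tangent_space_zero[OF \<eta> that])
  ultimately show ?thesis unfolding tangent_space_def mem_Collect_eq by blast
qed

lemma coord_vector_in_tangent_space:
  assumes M: "smooth_manifold M" and c: "c \<in> charts_at M p"
  shows "coord_vector M c p v \<in> tangent_space M p"
proof -
  have "coord_deriv d e (\<lambda>q. q) p (coord_deriv c d (\<lambda>q. q) p v) = coord_deriv c e (\<lambda>q. q) p v"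
    if "d \<in> charts_at M p" "e \<in> charts_at M p" for d e
    by (rule coord_deriv_comp[OF M M smooth_map_ident[OF M] smooth_map_ident[OF M] refl c that,
          symmetric])
  then show ?thesis by (simp add: tangent_space_def coord_vector_def)
qed

lemma coord_vector_linear:
  assumes M: "smooth_manifold M" and c: "c \<in> charts_at M p"
  shows "coord_vector M c p (a *\<^sub>R v + b *\<^sub>R w) =
    (\<lambda>d. a *\<^sub>R coord_vector M c p v d + b *\<^sub>R coord_vector M c p w d)"
proof
  fix d
  show "coord_vector M c p (a *\<^sub>R v + b *\<^sub>R w) d =
      a *\<^sub>R coord_vector M c p v d + b *\<^sub>R coord_vector M c p w d"
    using linear_coord_deriv[OF smooth_map_ident[OF M] c, of d]
    by (simp add: coord_vector_def linear_add linear_scale)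
qed

text \<open>The arbitrary chart in the definition of the differential may be replaced by any other.\<close>

lemma differential_in_chart:
  assumes M: "smooth_manifold M" and f: "smooth_map M N f"
    and \<xi>: "\<xi> \<in> tangent_space M p" and c: "c \<in> charts_at M p" and d: "d \<in> charts_at N (f p)"
  shows "differential M N f p \<xi> d = coord_deriv c d f p (\<xi> c)"
proof -
  let ?c = "SOME c. c \<in> charts_at M p"
  have c0: "?c \<in> charts_at M p" using c someI by metis
  have "coord_deriv ?c d f p (\<xi> ?c) = coord_deriv c d f p (coord_deriv ?c c (\<lambda>q. q) p (\<xi> ?c))"
    by (rule coord_deriv_comp[OF M M smooth_map_ident[OF M] f _ c0 c d]) simp
  also have "coord_deriv ?c c (\<lambda>q. q) p (\<xi> ?c) = \<xi> c"
    by (rule tangent_space_coord[OF \<xi> c0 c, symmetric])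
  finally show ?thesis using d by (simp add: differential_def Let_def)
qed

lemma differential_in_tangent_space:
  assumes M: "smooth_manifold M" and N: "smooth_manifold N" and f: "smooth_map M N f"
    and p: "p \<in> mcarrier M"
  shows "differential M N f p \<xi> \<in> tangent_space N (f p)"
proof -
  have c: "(SOME c. c \<in> charts_at M p) \<in> charts_at M p" by (rule some_chart_in[OF M p])
  have "coord_deriv d e (\<lambda>q. q) (f p) (coord_deriv (SOME c. c \<in> charts_at M p) d f p v) =
      coord_deriv (SOME c. c \<in> charts_at M p) e f p v"
    if "d \<in> charts_at N (f p)" "e \<in> charts_at N (f p)" for d e v
    by (rule coord_deriv_comp[OF M N f smooth_map_ident[OF N] refl c that, symmetric])
  then show ?thesis by (simp add: tangent_space_def differential_def Let_def)
qed

lemma differential_linear: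
  assumes M: "smooth_manifold M" and f: "smooth_map M N f" and p: "p \<in> mcarrier M"
  shows "differential M N f p (\<lambda>c. a *\<^sub>R \<xi> c + b *\<^sub>R \<eta> c) =
    (\<lambda>d. a *\<^sub>R differential M N f p \<xi> d + b *\<^sub>R differential M N f p \<eta> d)"
proof
  fix d
  show "differential M N f p (\<lambda>c. a *\<^sub>R \<xi> c + b *\<^sub>R \<eta> c) d =
      a *\<^sub>R differential M N f p \<xi> d + b *\<^sub>R differential M N f p \<eta> d"
    using linear_coord_deriv[OF f some_chart_in[OF M p], of d]
    by (simp add: differential_def Let_def linear_add linear_scale)
qed

lemma differential_comp:
  assumes M: "smooth_manifold M" and N: "smooth_manifold N"
    and f: "smooth_map M N f" and g: "smooth_map N K g"
    and h: "\<And>q. q \<in> mcarrier M \<Longrightarrow> h q = g (f q)" and p: "p \<in> mcarrier M"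
  shows "differential N K g (f p) (differential M N f p \<xi>) = differential M K h p \<xi>"
proof
  fix e
  let ?c = "SOME c. c \<in> charts_at M p" and ?d = "SOME d. d \<in> charts_at N (f p)"
  have c: "?c \<in> charts_at M p" by (rule some_chart_in[OF M p])
  have d: "?d \<in> charts_at N (f p)" by (rule some_chart_in[OF N smooth_map_in[OF f p]])
  show "differential N K g (f p) (differential M N f p \<xi>) e = differential M K h p \<xi> e"
    using coord_deriv_comp[OF M N f g h c d, of e] d h[OF p]
    by (simp add: differential_def Let_def)
qed

lemma differential_coord_vector:
  assumes M: "smooth_manifold M" and N: "smooth_manifold N" and f: "smooth_map M N f"
    and c: "c \<in> charts_at M p" and d: "d \<in> charts_at N (f p)"
  shows "differential M N f p (coord_vector M c p v) =
    coord_vector N d (f p) (coord_deriv c d f p v)"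
proof
  fix e
  have "coord_vector M c p v c = v"
    using c by (simp add: coord_vector_def coord_deriv_ident[OF M c])
  then have "differential M N f p (coord_vector M c p v) e = coord_deriv c e f p v"
    if "e \<in> charts_at N (f p)"
    using differential_in_chart[OF M f coord_vector_in_tangent_space[OF M c] c that] by simp
  then show "differential M N f p (coord_vector M c p v) e =
      coord_vector N d (f p) (coord_deriv c d f p v) e"
    using coord_deriv_comp[OF M N f smooth_map_ident[OF N] refl c d, of e v]
    by (simp add: coord_vector_def differential_def Let_def)
qed

section \<open>Pullback of forms\<close>

lemma alternating_multilinear_pullback:
  assumes \<alpha>: "alternating_multilinear k T' \<alpha>" and T: "\<And>\<xi>. \<xi> \<in> T \<Longrightarrow> D \<xi> \<in> T'"
    and lin: "\<And>a b \<xi> \<eta>. D (\<lambda>c. a *\<^sub>R \<xi> c + b *\<^sub>R \<eta> c) = (\<lambda>d. a *\<^sub>R D \<xi> d + b *\<^sub>R D \<eta> d)"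
  shows "alternating_multilinear k T (\<lambda>\<xi>s. \<alpha> (map D \<xi>s))"
  unfolding alternating_multilinear_def
proof (intro allI impI conjI ballI)
  fix \<xi>s i \<xi> \<eta> a b
  assume *: "length \<xi>s = k \<and> set \<xi>s \<subseteq> T" "i < k" "\<xi> \<in> T" "\<eta> \<in> T"
  then have "length (map D \<xi>s) = k \<and> set (map D \<xi>s) \<subseteq> T'" using T by auto
  with * show "\<alpha> (map D (\<xi>s[i := (\<lambda>c. a *\<^sub>R \<xi> c + b *\<^sub>R \<eta> c)])) =
      a * \<alpha> (map D (\<xi>s[i := \<xi>])) + b * \<alpha> (map D (\<xi>s[i := \<eta>]))"
    using \<alpha>[unfolded alternating_multilinear_def, rule_format, of "map D \<xi>s",
        THEN conjunct1, rule_format, of i "D \<xi>" "D \<eta>" a b] T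
    by (simp add: map_update lin)
next
  fix \<xi>s i j
  assume "length \<xi>s = k \<and> set \<xi>s \<subseteq> T" "i < k" "j < k" "i \<noteq> j \<and> \<xi>s ! i = \<xi>s ! j"
  then show "\<alpha> (map D \<xi>s) = 0"
    using \<alpha>[unfolded alternating_multilinear_def, rule_format, of "map D \<xi>s"] T
    by (metis (no_types, lifting) image_subset_iff length_map list.set_map nth_map subset_iff)
qed

text \<open>
  A pulled back form is given by its formula on tangent vectors only. Closure of \<open>T\<close> under linear
  combinations keeps the argument \<open>a \<xi> + b \<eta>\<close> within the range where the two maps agree.
\<close>

lemma alternating_multilinear_cong:
  assumes eq: "\<And>\<xi>s. set \<xi>s \<subseteq> T \<Longrightarrow> \<alpha> \<xi>s = \<beta> \<xi>s"
    and \<alpha>: "alternating_multilinear k T \<alpha>"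
    and T: "\<And>a b \<xi> \<eta>. \<xi> \<in> T \<Longrightarrow> \<eta> \<in> T \<Longrightarrow> (\<lambda>c. a *\<^sub>R \<xi> c + b *\<^sub>R \<eta> c) \<in> T"
  shows "alternating_multilinear k T \<beta>"
proof -
  have "\<alpha> (\<xi>s[i := \<xi>]) = \<beta> (\<xi>s[i := \<xi>])" if "set \<xi>s \<subseteq> T" "\<xi> \<in> T" for \<xi>s i \<xi>
    using that set_update_subset_insert[of \<xi>s i \<xi>] by (intro eq) blast
  then show ?thesis
    using \<alpha> T eq unfolding alternating_multilinear_def by simp
qed

lemma linear_in_slot:
  assumes M: "smooth_manifold M" and c: "c \<in> charts_at M p"
    and \<alpha>: "alternating_multilinear k (tangent_space M p) \<alpha>"
    and "set xs \<subseteq> tangent_space M p" "set ys \<subseteq> tangent_space M p"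
    and "length xs + Suc (length ys) = k"
  shows "linear (\<lambda>v. \<alpha> (xs @ coord_vector M c p v # ys))"
proof -
  let ?C = "coord_vector M c p"
  have *: "\<alpha> (xs @ ?C (a *\<^sub>R v + b *\<^sub>R w) # ys) =
      a * \<alpha> (xs @ ?C v # ys) + b * \<alpha> (xs @ ?C w # ys)" for a b v w
    using \<alpha>[unfolded alternating_multilinear_def, rule_format, of "xs @ ?C 0 # ys",
        THEN conjunct1, rule_format, of "length xs" "?C v" "?C w" a b] assms(4-6)
    by (simp add: coord_vector_linear[OF M c] coord_vector_in_tangent_space[OF M c])
  show ?thesis
    using *[of 1 _ 1] *[of _ _ 0] by (intro linearI) simp_all
qed

text \<open>
  By definition, the coefficients of a smooth form along constant coordinate vectors are smooth;
  this extends to coordinate vectors \<open>w x\<close> that vary smoothly. The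
  list of arguments is split into a varying part \<open>ws\<close> followed by a constant part \<open>vs\<close>. The last
  varying vector is expanded in a finite orthogonal family and thereby becomes the first of the
  constant ones, at the price of smooth scalar factors.
\<close>

lemma smooth_on_form_along:
  fixes N :: "('b, 'f::real_inner) manifold" and F :: "'e::real_normed_vector \<Rightarrow> 'f"
  assumes N: "smooth_manifold N" and \<omega>: "\<omega> \<in> forms k N" and d: "d \<in> atlas N"
    and U: "open U" and F: "smooth_on U F" "F ` U \<subseteq> snd d ` fst d"
    and "\<And>w. w \<in> set ws \<Longrightarrow> smooth_on U w" and "length ws + length vs = k"
  shows "smooth_on U (\<lambda>x. \<omega> (chart_inv d (F x))
    (map (\<lambda>w. coord_vector N d (chart_inv d (F x)) (w x)) ws
     @ map (coord_vector N d (chart_inv d (F x))) vs))"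
proof -
  have fin: "\<exists>B::'f set. finite B \<and> span B = UNIV"
    using N by (simp add: smooth_manifold_def)
  obtain B :: "'f set" where B: "finite B" "\<And>v. v = (\<Sum>b\<in>B. ((v \<bullet> b) / (b \<bullet> b)) *\<^sub>R b)"
    using orthogonal_expansion[OF fin] by blast
  show ?thesis
    using assms(7,8)
  proof (induction ws arbitrary: vs rule: rev_induct)
    case Nil
    have "smooth_on (snd d ` fst d)
        (\<lambda>y. \<omega> (chart_inv d y) (map (coord_vector N d (chart_inv d y)) vs))"
      using \<omega> d Nil.prems by (simp add: forms_def)
    from smooth_on_compose[OF fin U F(1) this F(2)] show ?case by simp
  next
    case (snoc w ws)
    let ?q = "\<lambda>x. chart_inv d (F x)"
    let ?C = "\<lambda>x. coord_vector N d (?q x)"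
    let ?L = "\<lambda>x. map (\<lambda>w. ?C x (w x)) ws"
    have IH: "smooth_on U (\<lambda>x. \<omega> (?q x) (?L x @ ?C x b # map (?C x) vs))" for b
      using snoc.IH[of "b # vs"] snoc.prems by simp
    have "smooth_on U (\<lambda>x. \<Sum>b\<in>B. ((w x \<bullet> b) / (b \<bullet> b)) *\<^sub>R
        \<omega> (?q x) (?L x @ ?C x b # map (?C x) vs))"
    proof (intro smooth_on_sum smooth_on_scaleR U IH)
      fix b :: 'f
      have "bounded_linear (\<lambda>u. (u \<bullet> b) / (b \<bullet> b))"
        by (rule bounded_linear_compose[OF bounded_linear_divide bounded_linear_inner_left])
      then show "smooth_on U (\<lambda>x. (w x \<bullet> b) / (b \<bullet> b))"
        using smooth_on_linear[of "\<lambda>u. (u \<bullet> b) / (b \<bullet> b)", OF _ U] snoc.prems(1)[of w] by simp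
    qed
    then show ?case
    proof (rule smooth_on_cong[OF U, rotated])
      fix x assume "x \<in> U"
      then have "F x \<in> snd d ` fst d" using F(2) by blast
      then have "?q x \<in> fst d" by (rule chart_inv_in)
      then have q: "d \<in> charts_at N (?q x)" using d by (simp add: charts_at_def)
      then have "?q x \<in> mcarrier N" by (rule charts_at_carrier[OF N])
      then have alt: "alternating_multilinear k (tangent_space N (?q x)) (\<omega> (?q x))"
        using \<omega> by (simp add: forms_def)
      define \<phi> where "\<phi> v = \<omega> (?q x) (?L x @ ?C x v # map (?C x) vs)" for v
      have lin: "linear \<phi>"
        unfolding \<phi>_def using alt snoc.prems(2) coord_vector_in_tangent_space[OF N q]
        by (intro linear_in_slot[OF N q]) auto
      have "\<phi> (w x) = (\<Sum>b\<in>B. ((w x \<bullet> b) / (b \<bullet> b)) *\<^sub>R \<phi> b)"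
        by (subst B(2)[of "w x"]) (simp add: linear_sum[OF lin] linear_scale[OF lin])
      then show "(\<Sum>b\<in>B. ((w x \<bullet> b) / (b \<bullet> b)) *\<^sub>R \<omega> (?q x) (?L x @ ?C x b # map (?C x) vs)) =
          \<omega> (?q x) (map (\<lambda>w. ?C x (w x)) (ws @ [w]) @ map (?C x) vs)"
        by (simp add: \<phi>_def)
    qed
  qed
qed

text \<open>
  Smoothness is local, so it may be checked where the map stays in one chart \<open>d\<close> of the target.
  There the differential carries the coordinate vector of a constant \<open>v\<close> to that of \<open>DF(x) v\<close>,
  where \<open>F\<close> is the local representation of the map; this is the situation of
  \<open>smooth_on_form_along\<close>.
\<close>

lemma pullback_form:
  assumes M: "smooth_manifold M" and N: "smooth_manifold N" and f: "smooth_map M N f"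
    and \<omega>: "\<omega> \<in> forms k N"
  shows "pullback M N f \<omega> \<in> forms k M"
proof -
  have alt: "alternating_multilinear k (tangent_space M p) (pullback M N f \<omega> p)"
    if p: "p \<in> mcarrier M" for p
  proof -
    have "alternating_multilinear k (tangent_space N (f p)) (\<omega> (f p))"
      using \<omega> smooth_map_in[OF f p] by (simp add: forms_def)
    then have "alternating_multilinear k (tangent_space M p)
        (\<lambda>\<xi>s. \<omega> (f p) (map (differential M N f p) \<xi>s))"
      by (rule alternating_multilinear_pullback)
        (simp_all add: differential_in_tangent_space[OF M N f p] differential_linear[OF M f p])
    then show ?thesis
    proof (rule alternating_multilinear_cong[rotated])
      show "(\<lambda>c. a *\<^sub>R \<xi> c + b *\<^sub>R \<eta> c) \<in> tangent_space M p"
        if "\<xi> \<in> tangent_space M p" "\<eta> \<in> tangent_space M p" for a b \<xi> \<eta>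
        using tangent_space_linear[OF M that] .
    qed (use p in \<open>simp add: pullback_def\<close>)
  qed
  have smooth: "smooth_on (snd c ` fst c)
      (\<lambda>x. pullback M N f \<omega> (chart_inv c x) (map (coord_vector M c (chart_inv c x)) vs))"
    (is "smooth_on _ ?g") if c: "c \<in> atlas M" and vs: "length vs = k" for c vs
  proof (rule smooth_on_local)
    fix x0 assume "x0 \<in> snd c ` fst c"
    then obtain p0 where p0: "x0 = snd c p0" "p0 \<in> fst c" by blast
    then have "f p0 \<in> mcarrier N" using smooth_map_in[OF f] chart_subset[OF M c] by blast
    then obtain d where d: "d \<in> atlas N" "f p0 \<in> fst d"
      using charts_at_nonempty[OF N] unfolding charts_at_def by blast
    let ?U = "snd c ` (fst c \<inter> f -` fst d)" and ?F = "local_rep c d f"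
    have U: "open ?U" by (rule open_local_rep_domain[OF M N f c d(1)])
    have F: "smooth_on ?U ?F" using f c d(1) by (simp add: smooth_map_def)
    have FU: "?F ` ?U \<subseteq> snd d ` fst d"
      using chart_inv_left[OF M c] by (auto simp: local_rep_def)
    have "smooth_on ?U (\<lambda>x. \<omega> (chart_inv d (?F x))
        (map (\<lambda>w. coord_vector N d (chart_inv d (?F x)) (w x))
          (map (\<lambda>v x. frechet_derivative ?F (at x) v) vs)
         @ map (coord_vector N d (chart_inv d (?F x))) []))"
      by (rule smooth_on_form_along[OF N \<omega> d(1) U F FU])
        (use vs smooth_on_derivative[OF F] in auto)
    then have "smooth_on ?U ?g"
    proof (rule smooth_on_cong[OF U, rotated])
      fix x assume "x \<in> ?U"
      then obtain p where p: "x = snd c p" "p \<in> fst c" "f p \<in> fst d" by auto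
      have cp: "c \<in> charts_at M p" and dp: "d \<in> charts_at N (f p)"
        using c d p by (auto simp: charts_at_def)
      have inv: "chart_inv c x = p" "chart_inv d (?F x) = f p"
        using p chart_inv_left[OF M c] chart_inv_left[OF N d(1)] by (auto simp: local_rep_def)
      have "frechet_derivative ?F (at x) = coord_deriv c d f p"
        by (simp add: coord_deriv_def p(1))
      then show "\<omega> (chart_inv d (?F x))
        (map (\<lambda>w. coord_vector N d (chart_inv d (?F x)) (w x))
          (map (\<lambda>v x. frechet_derivative ?F (at x) v) vs)
         @ map (coord_vector N d (chart_inv d (?F x))) []) = ?g x"
        using charts_at_carrier[OF M cp] coord_vector_in_tangent_space[OF M cp]
        by (auto simp: inv pullback_def differential_coord_vector[OF M N f cp dp] comp_def)
    qed
    then show "\<exists>U. open U \<and> x0 \<in> U \<and> smooth_on U ?g"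
      using U p0 d(2) by blast
  qed
  have "pullback M N f \<omega> p \<xi>s = 0"
    if "\<not> (p \<in> mcarrier M \<and> length \<xi>s = k \<and> set \<xi>s \<subseteq> tangent_space M p)" for p \<xi>s
    using that \<omega> by (auto simp: pullback_def forms_def)
  with alt smooth show ?thesis unfolding forms_def by blast
qed

lemma forms_diff:
  assumes M: "smooth_manifold M" and "\<alpha> \<in> forms k M" "\<beta> \<in> forms k M"
  shows "\<alpha> - \<beta> \<in> forms k M"
proof -
  have "alternating_multilinear k (tangent_space M p) ((\<alpha> - \<beta>) p)" if "p \<in> mcarrier M" for p
  proof -
    have "alternating_multilinear k (tangent_space M p) (\<alpha> p)"
      "alternating_multilinear k (tangent_space M p) (\<beta> p)"
      using assms that by (auto simp: forms_def)
    then show ?thesis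
      unfolding alternating_multilinear_def by (simp add: algebra_simps)
  qed
  moreover have "smooth_on (snd c ` fst c)
      (\<lambda>x. (\<alpha> - \<beta>) (chart_inv c x) (map (coord_vector M c (chart_inv c x)) vs))"
    if "c \<in> atlas M" "length vs = k" for c vs
    unfolding minus_apply
    by (rule smooth_on_diff[OF chart_image_open[OF M that(1)]])
      (use that assms(2,3) in \<open>simp_all add: forms_def\<close>)
  moreover have "(\<alpha> - \<beta>) p \<xi>s = 0"
    if "\<not> (p \<in> mcarrier M \<and> length \<xi>s = k \<and> set \<xi>s \<subseteq> tangent_space M p)" for p \<xi>s
    using that assms(2,3) by (auto simp: forms_def)
  ultimately show ?thesis unfolding forms_def by blast
qed

lemma pullback_diff: "pullback M N f (\<alpha> - \<beta>) = pullback M N f \<alpha> - pullback M N f \<beta>"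
  by (auto simp: pullback_def fun_eq_iff)

lemma pullback_comp:
  assumes M: "smooth_manifold M" and N: "smooth_manifold N"
    and f: "smooth_map M N f" and g: "smooth_map N K g"
    and h: "\<And>q. q \<in> mcarrier M \<Longrightarrow> h q = g (f q)"
  shows "pullback M N f (pullback N K g \<omega>) = pullback M K h \<omega>"
proof (intro ext)
  fix p \<xi>s
  show "pullback M N f (pullback N K g \<omega>) p \<xi>s = pullback M K h \<omega> p \<xi>s"
  proof (cases "p \<in> mcarrier M")
    case p: True
    have "differential N K g (f p) \<circ> differential M N f p = differential M K h p"
      using differential_comp[OF M N f g h p] by (simp add: fun_eq_iff)
    then show ?thesis
      using smooth_map_in[OF f p] differential_in_tangent_space[OF M N f p] h[OF p]
      by (auto simp: pullback_def)
  qed (simp add: pullback_def)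
qed

section \<open>Projections of composable pairs\<close>

text \<open>
  The two projections of a product share one proof: \<open>\<pi>\<close> is the projection on points and \<open>L\<close> the
  one on model vectors. Around a given point a chart \<open>d\<close> of the factor is completed to a product
  chart \<open>e\<close>; the local representation of \<open>\<pi>\<close> in \<open>d\<close> is \<open>L\<close> applied to that of the inclusion in
  \<open>e\<close>.
\<close>

lemma smooth_map_project:
  assumes S: "smooth_manifold S" and i: "smooth_map S P (\<lambda>p. p)"
    and cont: "continuous_map (mtop P) (mtop N) \<pi>" and L: "bounded_linear L"
    and charts: "\<And>d p. d \<in> atlas N \<Longrightarrow> p \<in> mcarrier P \<Longrightarrow> \<pi> p \<in> fst d \<Longrightarrow>
      \<exists>e\<in>atlas P. openin (mtop P) (fst e) \<and> p \<in> fst e \<and>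
        (\<forall>q. L (snd e q) = snd d (\<pi> q))"
  shows "smooth_map S N \<pi>"
  unfolding smooth_map_def
proof (intro conjI ballI)
  have ic: "continuous_map (mtop S) (mtop P) (\<lambda>p. p)" using i by (simp add: smooth_map_def)
  show "continuous_map (mtop S) (mtop N) \<pi>"
    using continuous_map_compose[OF ic cont] by (simp add: comp_def)
  fix c d assume c: "c \<in> atlas S" and d: "d \<in> atlas N"
  show "smooth_on (snd c ` (fst c \<inter> \<pi> -` fst d)) (local_rep c d \<pi>)"
  proof (rule smooth_on_local)
    fix x assume "x \<in> snd c ` (fst c \<inter> \<pi> -` fst d)"
    then obtain p where p: "x = snd c p" "p \<in> fst c" "\<pi> p \<in> fst d" by auto
    then have "p \<in> mcarrier P" using smooth_map_in[OF i] chart_subset[OF S c] by blast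
    with charts[OF d _ p(3)] obtain e where e: "e \<in> atlas P" "openin (mtop P) (fst e)" "p \<in> fst e"
      "\<And>q. L (snd e q) = snd d (\<pi> q)" by blast
    let ?U = "snd c ` (fst c \<inter> (\<lambda>p. p) -` fst e)"
    have U: "open ?U" by (rule open_chart_domain[OF S c ic e(2)])
    have "smooth_on ?U (local_rep c e (\<lambda>p. p))" using i c e(1) by (simp add: smooth_map_def)
    then have "smooth_on ?U (\<lambda>x. L (local_rep c e (\<lambda>p. p) x))" by (rule smooth_on_linear[OF L U])
    moreover have "(\<lambda>x. L (local_rep c e (\<lambda>p. p) x)) = local_rep c d \<pi>"
      by (simp add: fun_eq_iff local_rep_def e(4))
    ultimately show "\<exists>U. open U \<and> x \<in> U \<and> smooth_on U (local_rep c d \<pi>)"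
      using U p e(3) by auto
  qed
qed

lemma smooth_map_projections:
  assumes M: "smooth_manifold M" and N: "smooth_manifold N" and S: "smooth_manifold S"
    and i: "smooth_map S (prod_manifold M N) (\<lambda>p. p)"
  shows smooth_map_fst: "smooth_map S M fst" and smooth_map_snd: "smooth_map S N snd"
proof -
  let ?prod = "\<lambda>c d. (fst c \<times> fst d, map_prod (snd c) (snd d))"
  have atl: "?prod c d \<in> atlas (prod_manifold M N)" if "c \<in> atlas M" "d \<in> atlas N" for c d
    unfolding prod_manifold_def manifold.select_convs mem_Collect_eq
    by (intro exI[of _ c] exI[of _ d] conjI refl that)
  have op: "openin (mtop (prod_manifold M N)) (fst c \<times> fst d)"
    if "c \<in> atlas M" "d \<in> atlas N" for c d
    using chart_domain_open[OF M that(1)] chart_domain_open[OF N that(2)]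
    by (simp add: prod_manifold_def openin_prod_Times_iff)
  show "smooth_map S M fst"
  proof (rule smooth_map_project[OF S i _ bounded_linear_fst])
    fix d p assume d: "d \<in> atlas M" and p: "p \<in> mcarrier (prod_manifold M N)" "fst p \<in> fst d"
    then obtain e where "e \<in> atlas N" "snd p \<in> fst e"
      using charts_at_nonempty[OF N, of "snd p"] by (auto simp: prod_manifold_def charts_at_def)
    then show "\<exists>e\<in>atlas (prod_manifold M N). openin (mtop (prod_manifold M N)) (fst e) \<and>
        p \<in> fst e \<and> (\<forall>q. fst (snd e q) = snd d (fst q))"
      using atl[OF d] op[OF d] p by (intro bexI[of _ "?prod d e"]) (auto simp: mem_Times_iff)
  qed (simp add: prod_manifold_def continuous_map_fst)
  show "smooth_map S N snd"
  proof (rule smooth_map_project[OF S i _ bounded_linear_snd])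
    fix d p assume d: "d \<in> atlas N" and p: "p \<in> mcarrier (prod_manifold M N)" "snd p \<in> fst d"
    then obtain e where "e \<in> atlas M" "fst p \<in> fst e"
      using charts_at_nonempty[OF M, of "fst p"] by (auto simp: prod_manifold_def charts_at_def)
    then show "\<exists>e\<in>atlas (prod_manifold M N). openin (mtop (prod_manifold M N)) (fst e) \<and>
        p \<in> fst e \<and> (\<forall>q. snd (snd e q) = snd d (snd q))"
      using atl[OF _ d] op[OF _ d] p by (intro bexI[of _ "?prod e d"]) (auto simp: mem_Times_iff)
  qed (simp add: prod_manifold_def continuous_map_snd)
qed

section \<open>Affine and multiplicative forms\<close>

theorem proposition4p3:
  fixes \<G> :: "('g, 'm, 'eg::real_inner, 'em::real_inner, 'ep::real_inner) groupoid_data"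
    and k :: nat
    and \<Theta> \<Theta>\<^sub>l \<Theta>\<^sub>r :: "('g, 'eg) form"
    and \<theta> :: "('m, 'em) form"
  assumes "lie_groupoid \<G>"
    and "\<Theta> \<in> forms k (arrows \<G>)"
    and "\<theta> = base_form \<G> \<Theta>"
    and "\<Theta>\<^sub>l = \<Theta> - pullback (arrows \<G>) (base \<G>) (src \<G>) \<theta>"
    and "\<Theta>\<^sub>r = \<Theta> - pullback (arrows \<G>) (base \<G>) (tgt \<G>) \<theta>"
  shows "(affine_form \<G> k \<Theta> \<longleftrightarrow> multiplicative_form \<G> k \<Theta>\<^sub>l) \<and>
         (affine_form \<G> k \<Theta> \<longleftrightarrow> multiplicative_form \<G> k \<Theta>\<^sub>r)"
proof -
  let ?G = "arrows \<G>" and ?M = "base \<G>" and ?P = "pairs \<G>"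
  let ?s = "pullback ?G ?M (src \<G>) \<theta>" and ?t = "pullback ?G ?M (tgt \<G>) \<theta>"
  have G: "smooth_manifold ?G" and M: "smooth_manifold ?M" and P: "smooth_manifold ?P"
    and s: "smooth_map ?G ?M (src \<G>)" and t: "smooth_map ?G ?M (tgt \<G>)"
    and u: "smooth_map ?M ?G (unit \<G>)" and m: "smooth_map ?P ?G (mult \<G>)"
    and i: "smooth_map ?P (prod_manifold ?G ?G) (\<lambda>p. p)"
    using assms(1)
    unfolding lie_groupoid_def submersion_def embedded_submanifold_def immersion_def by blast+
  have pairs: "mcarrier ?P = {(g, h). g \<in> mcarrier ?G \<and> h \<in> mcarrier ?G \<and> src \<G> g = tgt \<G> h}"
    and alg: "algebraic_groupoid \<G>"
    using assms(1) unfolding lie_groupoid_def by blast+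
  have pr1: "smooth_map ?P ?G fst" and pr2: "smooth_map ?P ?G snd"
    using smooth_map_projections[OF G G P i] by auto
  have \<theta>: "\<theta> \<in> forms k ?M"
    using pullback_form[OF M G u assms(2)] by (simp add: assms(3) base_form_def)
  have forms: "\<Theta>\<^sub>l \<in> forms k ?G" "\<Theta>\<^sub>r \<in> forms k ?G"
    using forms_diff[OF G assms(2)] pullback_form[OF G M s \<theta>] pullback_form[OF G M t \<theta>]
    by (simp_all add: assms(4,5))

  have st: "src \<G> (mult \<G> q) = src \<G> (snd q)" "tgt \<G> (mult \<G> q) = tgt \<G> (fst q)"
    "src \<G> (fst q) = tgt \<G> (snd q)" if "q \<in> mcarrier ?P" for q
    using that alg by (auto simp: pairs algebraic_groupoid_def Let_def)
  have ms: "pullback ?P ?G (mult \<G>) ?s = pullback ?P ?G snd ?s"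
    using pullback_comp[OF P G m s, of "\<lambda>q. src \<G> (mult \<G> q)"]
      pullback_comp[OF P G pr2 s, of "\<lambda>q. src \<G> (mult \<G> q)"] st by simp
  have mt: "pullback ?P ?G (mult \<G>) ?t = pullback ?P ?G fst ?t"
    using pullback_comp[OF P G m t, of "\<lambda>q. tgt \<G> (mult \<G> q)"]
      pullback_comp[OF P G pr1 t, of "\<lambda>q. tgt \<G> (mult \<G> q)"] st by simp
  have ts: "pullback ?P ?G snd ?t = pullback ?P ?G fst ?s"
    using pullback_comp[OF P G pr2 t, of "\<lambda>q. src \<G> (fst q)"]
      pullback_comp[OF P G pr1 s, of "\<lambda>q. src \<G> (fst q)"] st by simp

  have "affine_form \<G> k \<Theta> \<longleftrightarrow> multiplicative_form \<G> k \<Theta>\<^sub>l"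
    using assms(2) forms(1)
    by (simp add: affine_form_def multiplicative_form_def assms(3)[symmetric] assms(4)
        pullback_diff ms algebra_simps)
  moreover have "affine_form \<G> k \<Theta> \<longleftrightarrow> multiplicative_form \<G> k \<Theta>\<^sub>r"
    using assms(2) forms(2)
    by (simp add: affine_form_def multiplicative_form_def assms(3)[symmetric] assms(5)
        pullback_diff mt ts algebra_simps)
  ultimately show ?thesis by blast
qed

end
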